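(* Let $n \ge 2$ be an integer, let $A \in \mathbb{R}^{n \times n}$ and $b, c \in \mathbb{R}^n$, and define $f : \mathbb{R}^n \to \mathbb{R}^n$ by $$f(x) = A x + b|x_1| + c,$$ where $x_1$ denotes the first component of $x \in \mathbb{R}^n$. Let $P \in \mathbb{R}^{n \times (n-1)}$ denote the matrix formed by the second through $n^{\rm th}$ columns of $I - A$, where $I$ is the $n \times n$ identity matrix. If $P$ has full rank (i.e. its columns are linearly independent) and there exists $x \in \mathbb{R}^n$ such that $\| f^k(x) \| \not\to \infty$ as $k \to \infty$, then $f$ has a fixed point in $\mathbb{R}^n$, that is, there exists $x^* \in \mathbb{R}^n$ with $f(x^* ) = x^*$.
   Context: $f^k(x)$ denotes the $k^{\rm th}$ iterate of $x$ under $f$, and $\|\cdot\|$ is a norm on $\mathbb{R}^n$ (e.g. the Euclidean norm). The condition $\| f^k(x) \| \not\to \infty$ means that it is not the case that $\|f^k(x)\|$ tends to infinity as $k \to \infty$. *)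

theory Defs
  imports Complex_Main "Jordan_Normal_Form.DL_Rank"
begin

(* Vectors and matrices are those of Jordan_Normal_Form, so the dimension n is an ordinary natural
   number and indices start at 0: the first component of x is x $ 0. *)

definition is_norm :: "nat \<Rightarrow> (real vec \<Rightarrow> real) \<Rightarrow> bool" where
  "is_norm n N \<longleftrightarrow>
     (\<forall>x \<in> carrier_vec n. N x \<ge> 0) \<and>
     (\<forall>x \<in> carrier_vec n. N x = 0 \<longleftrightarrow> x = 0\<^sub>v n) \<and>
     (\<forall>a. \<forall>x \<in> carrier_vec n. N (a \<cdot>\<^sub>v x) = \<bar>a\<bar> * N x) \<and>
     (\<forall>x \<in> carrier_vec n. \<forall>y \<in> carrier_vec n. N (x + y) \<le> N x + N y)"

definition pwl_map :: "real mat \<Rightarrow> real vec \<Rightarrow> real vec \<Rightarrow> real vec \<Rightarrow> real vec" where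
  "pwl_map A b c x = A *\<^sub>v x + \<bar>x $ 0\<bar> \<cdot>\<^sub>v b + c"

definition trailing_cols :: "nat \<Rightarrow> real mat \<Rightarrow> real mat" where
  "trailing_cols n M = mat n (n - 1) (\<lambda>(i, j). M $$ (i, Suc j))"

end

theory Submission
  imports Defs "HOL-Analysis.Function_Topology" "HOL-Analysis.Product_Topology"
begin

text \<open>
  Choose \<open>v \<noteq> 0\<close> orthogonal to the columns of \<open>P\<close>; by full rank, the range of \<open>P\<close> is exactly the
  orthogonal complement of \<open>v\<close>. Then \<open>v \<bullet> f x - v \<bullet> x = h (x\<^sub>1)\<close> for a function of the form
  \<open>h t = p t + q \<bar>t\<bar> + g\<close>, and a zero of \<open>h\<close> is the same as the first coordinate of a fixed point.
  If \<open>h\<close> has no zero, then by positive homogeneity of \<open>p t + q \<bar>t\<bar>\<close> it stays at least \<open>\<bar>g\<bar> > 0\<close> away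
  from zero with the sign of \<open>g\<close>, so \<open>v \<bullet> f\<^sup>k x\<close> grows linearly and every orbit tends to infinity
  in norm.
\<close>

section \<open>Abstract norms and their comparison with the l1 norm\<close>

lemma is_norm_triangle:
  assumes "is_norm n N" "x \<in> carrier_vec n" "y \<in> carrier_vec n"
  shows "N (x + y) \<le> N x + N y"
  using assms by (simp add: is_norm_def)

text \<open>Expand in unit vectors and use the triangle inequality. The induction runs over the
  number \<open>k\<close> of coordinates kept, the rest being zeroed, so that every vector involved
  stays in dimension \<open>n\<close>.\<close>

lemma is_norm_vec_le_sum:
  assumes "is_norm n N"
  shows "N (vec n f) \<le> (\<Sum>i<n. \<bar>f i\<bar> * N (unit_vec n i))"
proof -
  have "N (vec n (\<lambda>i. if i < k then f i else 0)) \<le> (\<Sum>i<k. \<bar>f i\<bar> * N (unit_vec n i))"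
    if "k \<le> n" for k
    using that
  proof (induction k)
    case 0
    have "vec n (\<lambda>i. 0 :: real) = 0\<^sub>v n"
      by auto
    moreover have "N (0\<^sub>v n) = 0"
      using assms unfolding is_norm_def by (metis zero_carrier_vec)
    ultimately show ?case
      by simp
  next
    case (Suc k)
    have "vec n (\<lambda>i. if i < Suc k then f i else 0)
        = vec n (\<lambda>i. if i < k then f i else 0) + f k \<cdot>\<^sub>v unit_vec n k"
      using Suc.prems by (intro eq_vecI) (auto simp: less_Suc_eq)
    then have "N (vec n (\<lambda>i. if i < Suc k then f i else 0))
        \<le> N (vec n (\<lambda>i. if i < k then f i else 0)) + N (f k \<cdot>\<^sub>v unit_vec n k)"
      by (auto intro: is_norm_triangle[OF assms])
    also have "N (f k \<cdot>\<^sub>v unit_vec n k) = \<bar>f k\<bar> * N (unit_vec n k)"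
      using assms by (simp add: is_norm_def)
    finally show ?case
      using Suc by simp
  qed
  from this[of n] have "N (vec n (\<lambda>i. if i < n then f i else 0)) \<le> (\<Sum>i<n. \<bar>f i\<bar> * N (unit_vec n i))"
    by simp
  moreover have "vec n (\<lambda>i. if i < n then f i else 0) = vec n f"
    by auto
  ultimately show ?thesis
    by simp
qed

lemma is_norm_vec_diff_le:
  assumes "is_norm n N"
  shows "\<bar>N (vec n f) - N (vec n g)\<bar> \<le> (\<Sum>i<n. \<bar>f i - g i\<bar> * N (unit_vec n i))"
proof -
  have "N (vec n f) - N (vec n g) \<le> (\<Sum>i<n. \<bar>f i - g i\<bar> * N (unit_vec n i))" for f g
  proof -
    have "vec n f = vec n g + vec n (\<lambda>i. f i - g i)"
      by auto
    then have "N (vec n f) \<le> N (vec n g) + N (vec n (\<lambda>i. f i - g i))"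
      using assms by (simp add: is_norm_def)
    then show ?thesis
      using is_norm_vec_le_sum[OF assms, of "\<lambda>i. f i - g i"] by linarith
  qed
  from this[of f g] this[of g f] show ?thesis
    by (simp add: abs_minus_commute abs_le_iff)
qed

text \<open>Coordinate functions \<open>nat \<Rightarrow> real\<close> with the product topology
  stand in for vectors, which makes compactness arguments available. Continuity holds because the
  difference of norms is dominated by a finite sum of coordinate differences.\<close>

lemma continuous_on_is_norm_vec:
  assumes "is_norm n N"
  shows "continuous_on S (\<lambda>f. N (vec n f))"
  unfolding continuous_on_def
proof
  fix f assume "f \<in> S"
  have "((\<lambda>g. \<Sum>i<n. \<bar>g i - f i\<bar> * N (unit_vec n i)) \<longlongrightarrow>
      (\<Sum>i<n. \<bar>f i - f i\<bar> * N (unit_vec n i))) (at f within S)"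
    using continuous_on_subset[OF continuous_on_product_coordinates subset_UNIV, of S] \<open>f \<in> S\<close>
    by (intro tendsto_intros) (auto simp: continuous_on_def)
  then show "((\<lambda>g. N (vec n g)) \<longlongrightarrow> N (vec n f)) (at f within S)"
  proof (rule metric_tendsto_imp_tendsto[OF _ always_eventually], intro allI)
    fix g
    show "dist (N (vec n g)) (N (vec n f)) \<le> dist (\<Sum>i<n. \<bar>g i - f i\<bar> * N (unit_vec n i))
        (\<Sum>i<n. \<bar>f i - f i\<bar> * N (unit_vec n i))"
      using is_norm_vec_diff_le[OF assms, of g f] by (simp add: dist_real_def)
  qed
qed

text \<open>The usual half of norm equivalence: \<open>N\<close> attains a positive minimum
  \<open>m\<close> on the compact l1 unit sphere, and homogeneity extends the bound to all
  vectors.\<close>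

lemma is_norm_ge_l1:
  assumes "is_norm n N"
  obtains m where "m > 0" "\<And>x. x \<in> carrier_vec n \<Longrightarrow> m * (\<Sum>i<n. \<bar>x $ i\<bar>) \<le> N x"
proof -
  \<comment> \<open>Coordinates from \<open>n\<close> on are pinned to 0, so \<open>K\<close> is a
    product of compact sets over all of \<open>nat\<close>, compact by Tychonoff; \<open>S\<close>
    is the l1 unit sphere inside it.\<close>
  define K :: "(nat \<Rightarrow> real) set" where "K = PiE UNIV (\<lambda>i. if i < n then {-1..1} else {0})"
  define S where "S = K \<inter> {f. (\<Sum>i<n. \<bar>f i\<bar>) = 1}"
  have "compactin (product_topology (\<lambda>i. euclidean) UNIV) K"
    unfolding K_def by (subst compactin_PiE) auto
  then have "compact K"
    by (simp add: euclidean_product_topology)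
  moreover have "closed {f :: nat \<Rightarrow> real. (\<Sum>i<n. \<bar>f i\<bar>) = 1}"
    by (intro closed_Collect_eq continuous_intros continuous_on_product_coordinates)
  ultimately have "compact S"
    unfolding S_def by (rule compact_Int_closed)
  have normalise: "(\<lambda>i. if i < n then x $ i / (\<Sum>i<n. \<bar>x $ i\<bar>) else 0) \<in> S"
    if "(\<Sum>i<n. \<bar>x $ i\<bar>) \<noteq> 0" for x :: "real vec"
  proof -
    let ?s = "\<Sum>i<n. \<bar>x $ i\<bar>"
    have pos: "?s > 0"
      using that sum_nonneg[of "{..<n}" "\<lambda>i. \<bar>x $ i\<bar>"] by linarith
    have "\<bar>x $ i\<bar> \<le> ?s" if "i < n" for i
      using that by (intro member_le_sum) auto
    then have "x $ i \<le> ?s" "- ?s \<le> x $ i" if "i < n" for i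
      using that by (simp_all add: abs_le_iff minus_le_iff)
    then show ?thesis
      using pos by (auto simp: S_def K_def PiE_iff divide_le_eq le_divide_eq simp flip: sum_divide_distrib)
  qed
  have "\<exists>m>0. \<forall>f\<in>S. m \<le> N (vec n f)"
  proof (cases "S = {}")
    case False
    then obtain f where f: "f \<in> S" "\<And>g. g \<in> S \<Longrightarrow> N (vec n f) \<le> N (vec n g)"
      using continuous_attains_inf[OF \<open>compact S\<close> _ continuous_on_is_norm_vec[OF assms]] by blast
    have "vec n f \<noteq> 0\<^sub>v n"
    proof
      assume "vec n f = 0\<^sub>v n"
      then have "f i = 0" if "i < n" for i
        using that by (metis index_vec index_zero_vec(1))
      then show False
        using f(1) by (simp add: S_def)
    qed
    then have "N (vec n f) > 0"
      using assms by (auto simp: is_norm_def order_le_less)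
    then show ?thesis
      using f by blast
  \<comment> \<open>The sphere is empty only for \<open>n = 0\<close>, where any positive constant
    serves.\<close>
  qed (auto intro: exI[of _ 1])
  then obtain m where m: "m > 0" "\<And>f. f \<in> S \<Longrightarrow> m \<le> N (vec n f)"
    by blast
  have "m * (\<Sum>i<n. \<bar>x $ i\<bar>) \<le> N x" if x: "x \<in> carrier_vec n" for x
  proof (cases "(\<Sum>i<n. \<bar>x $ i\<bar>) = 0")
    case True
    then show ?thesis
      using assms x by (simp add: is_norm_def)
  next
    case False
    let ?s = "\<Sum>i<n. \<bar>x $ i\<bar>"
    have "x = ?s \<cdot>\<^sub>v vec n (\<lambda>i. if i < n then x $ i / ?s else 0)"
      using x False by (intro eq_vecI) auto
    then have "N x = \<bar>?s\<bar> * N (vec n (\<lambda>i. if i < n then x $ i / ?s else 0))"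
      using assms unfolding is_norm_def by (metis vec_carrier)
    moreover have "\<bar>?s\<bar> * m \<le> \<bar>?s\<bar> * N (vec n (\<lambda>i. if i < n then x $ i / ?s else 0))"
      by (intro mult_left_mono m normalise False) auto
    ultimately show ?thesis
      by (simp add: sum_nonneg mult.commute)
  qed
  with m(1) show ?thesis
    by (rule that)
qed

lemma scalar_prod_le_is_norm:
  assumes "is_norm n N" "v \<in> carrier_vec n"
  obtains C where "C > 0" "\<And>x. x \<in> carrier_vec n \<Longrightarrow> v \<bullet> x \<le> C * N x"
proof -
  obtain m where m: "m > 0" "\<And>x. x \<in> carrier_vec n \<Longrightarrow> m * (\<Sum>i<n. \<bar>x $ i\<bar>) \<le> N x"
    using is_norm_ge_l1[OF assms(1)] by blast
  \<comment> \<open>The summand 1 keeps \<open>V\<close> positive even when \<open>v\<close> is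
    zero.\<close>
  define V where "V = 1 + (\<Sum>i<n. \<bar>v $ i\<bar>)"
  have "V > 0"
    unfolding V_def by (rule add_pos_nonneg) (auto simp: sum_nonneg)
  have "v \<bullet> x \<le> V / m * N x" if x: "x \<in> carrier_vec n" for x
  proof -
    have "v $ i * x $ i \<le> V * \<bar>x $ i\<bar>" if "i < n" for i
    proof -
      have "\<bar>v $ i\<bar> \<le> V"
        using that member_le_sum[of i "{..<n}" "\<lambda>i. \<bar>v $ i\<bar>"] by (simp add: V_def)
      then have "\<bar>v $ i\<bar> * \<bar>x $ i\<bar> \<le> V * \<bar>x $ i\<bar>"
        by (simp add: mult_right_mono)
      then show ?thesis
        by (metis abs_ge_self abs_mult order_trans)
    qed
    then have "v \<bullet> x \<le> V * (\<Sum>i<n. \<bar>x $ i\<bar>)"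
      using x by (auto simp: scalar_prod_def sum_distrib_left lessThan_atLeast0 intro!: sum_mono)
    also have "\<dots> \<le> V * (N x / m)"
      using m(1) m(2)[OF x] \<open>V > 0\<close> by (intro mult_left_mono) (auto simp: field_simps)
    finally show ?thesis
      by simp
  qed
  moreover have "V / m > 0"
    using \<open>V > 0\<close> m(1) by simp
  ultimately show ?thesis
    using that by blast
qed

section \<open>Kernel and range of a full-rank matrix\<close>

text \<open>Rank is computed from the set of columns, so repetitions must be excluded first: a
  maximal independent subset has \<open>nc\<close> elements, which forces the \<open>nc\<close>
  columns to be distinct. A nonzero kernel vector would then make them dependent.\<close>

lemma (in vec_space) full_rank_mult_eq_0:
  assumes A: "A \<in> carrier_mat n nc" and "rank A = nc"
    and v: "v \<in> carrier_vec nc" "A *\<^sub>v v = 0\<^sub>v n"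
  shows "v = 0\<^sub>v nc"
proof -
  obtain S where S: "maximal S (\<lambda>T. T \<subseteq> set (cols A) \<and> lin_indpt T)"
    using maximal_exists[of "(\<lambda>T. T \<subseteq> set (cols A) \<and> lin_indpt T)" "card (set (cols A))" "{}"]
    by (meson List.finite_set card_mono empty_iff empty_subsetI finite_lin_indpt2 rev_finite_subset)
  then have "card S \<le> card (set (cols A))"
    by (simp add: card_mono maximal_def)
  moreover have "card S = nc"
    using rank_card_indpt[OF A S] assms(2) by simp
  ultimately have "distinct (cols A)"
    using A card_length[of "cols A"] by (intro card_distinct) simp
  then show ?thesis
    using full_rank_lin_indpt[OF A assms(2)] lin_depI[OF A v(1) _ v(2)] by blast
qed

text \<open>Replacing column 0 of \<open>M\<close> by zero gives a singular square matrix
  \<open>B\<close>; its transpose is singular too, and a kernel vector of the transpose is the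
  required \<open>v\<close>.\<close>

lemma trailing_cols_left_kernel:
  fixes M :: "real mat"
  assumes "n > 0"
  obtains v where "v \<in> carrier_vec n" "v \<noteq> 0\<^sub>v n"
    "\<And>j. 0 < j \<Longrightarrow> j < n \<Longrightarrow> (\<Sum>i<n. M $$ (i, j) * v $ i) = 0"
proof -
  define B where "B = mat n n (\<lambda>(i, j). if j = 0 then 0 else M $$ (i, j))"
  have B: "B \<in> carrier_mat n n"
    by (simp add: B_def)
  have "B *\<^sub>v unit_vec n 0 = 0\<^sub>v n"
    by (intro eq_vecI) (auto simp: B_def scalar_prod_def unit_vec_def intro!: sum.neutral)
  moreover have "unit_vec n 0 \<noteq> (0\<^sub>v n :: real vec)"
    using assms by simp
  ultimately have "det B = 0"
    using det_0_iff_vec_prod_zero_field[OF B] by (metis unit_vec_carrier)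
  then have "det B\<^sup>T = 0"
    using det_transpose[OF B] by simp
  then obtain v where v: "v \<in> carrier_vec n" "v \<noteq> 0\<^sub>v n" "B\<^sup>T *\<^sub>v v = 0\<^sub>v n"
    using det_0_iff_vec_prod_zero_field[of "B\<^sup>T" n] B by auto
  have "(\<Sum>i<n. M $$ (i, j) * v $ i) = 0" if "0 < j" "j < n" for j
  proof -
    have "(B\<^sup>T *\<^sub>v v) $ j = 0"
      using v(3) that by simp
    then show ?thesis
      using that v(1) by (simp add: B_def scalar_prod_def lessThan_atLeast0)
  qed
  with v(1,2) show ?thesis
    by (rule that)
qed

lemma left_kernel_orthogonal_imp_range:
  fixes M :: "real mat"
  assumes "n \<ge> 2" and M: "M \<in> carrier_mat n n"
    and rank: "vec_space.rank n (trailing_cols n M) = n - 1"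
    and v: "v \<in> carrier_vec n" "v \<noteq> 0\<^sub>v n"
      "\<And>j. 0 < j \<Longrightarrow> j < n \<Longrightarrow> (\<Sum>i<n. M $$ (i, j) * v $ i) = 0"
    and y: "(\<Sum>i<n. y i * v $ i) = 0"
  obtains x where "x 0 = 0" "\<And>i. i < n \<Longrightarrow> (\<Sum>j<n. M $$ (i, j) * x j) = y i"
proof -
  \<comment> \<open>\<open>Q = [y | P]\<close> is singular because \<open>v\<close> annihilates its columns; a kernel vector of \<open>Q\<close> has a
    nonzero first entry by full rank, and so expresses \<open>y\<close> through the columns of \<open>P\<close>.\<close>
  define Q where "Q = mat n n (\<lambda>(i, j). if j = 0 then y i else M $$ (i, j))"
  have Q: "Q \<in> carrier_mat n n"
    by (simp add: Q_def)
  have "Q\<^sup>T *\<^sub>v v = 0\<^sub>v n"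
  proof (intro eq_vecI)
    fix j assume "j < dim_vec (0\<^sub>v n :: real vec)"
    then show "(Q\<^sup>T *\<^sub>v v) $ j = 0\<^sub>v n $ j"
      using v y by (cases "j = 0") (auto simp: Q_def scalar_prod_def simp flip: lessThan_atLeast0)
  qed (simp add: Q_def)
  then have "det Q\<^sup>T = 0"
    using det_0_iff_vec_prod_zero_field[of "Q\<^sup>T" n] Q v by auto
  then have "det Q = 0"
    using det_transpose[OF Q] by simp
  then obtain w where w: "w \<in> carrier_vec n" "w \<noteq> 0\<^sub>v n" "Q *\<^sub>v w = 0\<^sub>v n"
    using det_0_iff_vec_prod_zero_field[OF Q] by auto
  obtain k where n: "n = Suc k"
    using \<open>n \<ge> 2\<close> by (cases n) auto
  have Qw: "y i * w $ 0 + (\<Sum>j<k. M $$ (i, Suc j) * w $ Suc j) = 0" if "i < n" for i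
  proof -
    have "(Q *\<^sub>v w) $ i = 0"
      using w(3) that by simp
    then show ?thesis
      using that w(1) by (simp add: Q_def scalar_prod_def lessThan_atLeast0[symmetric] n sum.lessThan_Suc_shift del: sum.lessThan_Suc)
  qed
  have "w $ 0 \<noteq> 0"
  proof
    assume w0: "w $ 0 = 0"
    define w' where "w' = vec k (\<lambda>j. w $ Suc j)"
    have P: "trailing_cols n M \<in> carrier_mat n k"
      by (simp add: trailing_cols_def n)
    have "trailing_cols n M *\<^sub>v w' = 0\<^sub>v n"
      using Qw by (intro eq_vecI)
        (auto simp: trailing_cols_def w'_def scalar_prod_def w0 n simp flip: lessThan_atLeast0)
    then have "w' = 0\<^sub>v k"
      using vec_space.full_rank_mult_eq_0[OF P] rank n by (simp add: w'_def)
    then have "w $ Suc j = 0" if "j < k" for j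
      using that by (metis index_vec index_zero_vec(1) w'_def)
    then have "w = 0\<^sub>v n"
      using w(1) w0 n by (intro eq_vecI) (auto simp: less_Suc_eq_0_disj)
    with w(2) show False ..
  qed
  \<comment> \<open>Row \<open>i\<close> of \<open>Q w = 0\<close> is solved for \<open>y i\<close>
    by dividing by \<open>- w $ 0\<close>. The entry \<open>x 0 = 0\<close> removes column 0 of
    \<open>M\<close> from the combination.\<close>
  define x where "x j = (if j = 0 then 0 else - w $ j / w $ 0)" for j
  have "(\<Sum>j<n. M $$ (i, j) * x j) = y i" if "i < n" for i
  proof -
    have "(\<Sum>j<n. M $$ (i, j) * x j) = - (\<Sum>j<k. M $$ (i, Suc j) * w $ Suc j) / w $ 0"
      by (simp add: n x_def sum.lessThan_Suc_shift sum_divide_distrib sum_negf del: sum.lessThan_Suc)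
    also have "\<dots> = y i"
      using Qw[OF that] \<open>w $ 0 \<noteq> 0\<close> by (simp add: field_simps add_eq_0_iff)
    finally show ?thesis .
  qed
  then show ?thesis
    by (intro that[of x]) (auto simp: x_def)
qed

section \<open>The scalar drift function\<close>

text \<open>The factor \<open>g\<close> treats both signs at once: the claim amounts to
  \<open>g * (p * t + q * \<bar>t\<bar>) \<ge> 0\<close>.\<close>

lemma no_zero_imp_mult_ge_square:
  fixes p q g :: real
  assumes "\<And>t. p * t + q * \<bar>t\<bar> + g \<noteq> 0"
  shows "g * (p * t + q * \<bar>t\<bar> + g) \<ge> g\<^sup>2"
proof (rule ccontr)
  let ?d = "p * t + q * \<bar>t\<bar>"
  assume "\<not> ?thesis"
  then have neg: "g * ?d < 0"
    by (simp add: algebra_simps power2_eq_square)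
  \<comment> \<open>scaling \<open>t\<close> by \<open>s > 0\<close> scales \<open>p t + q \<bar>t\<bar>\<close> to \<open>- g\<close>\<close>
  define s where "s = - g / ?d"
  have "s > 0"
    using neg by (auto simp: s_def mult_less_0_iff intro: divide_pos_neg divide_neg_pos)
  then have "p * (s * t) + q * \<bar>s * t\<bar> = s * ?d"
    by (simp add: abs_mult algebra_simps)
  also have "\<dots> = - g"
    using neg by (auto simp: s_def)
  finally show False
    using assms[of "s * t"] by simp
qed

section \<open>Orbits and fixed points of the map\<close>

lemma pwl_map_carrier:
  assumes "A \<in> carrier_mat n n" "b \<in> carrier_vec n" "c \<in> carrier_vec n" "x \<in> carrier_vec n"
  shows "pwl_map A b c x \<in> carrier_vec n"
  using assms by (simp add: pwl_map_def)

lemma pwl_map_iterate_carrier: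
  assumes "A \<in> carrier_mat n n" "b \<in> carrier_vec n" "c \<in> carrier_vec n" "x \<in> carrier_vec n"
  shows "(pwl_map A b c ^^ k) x \<in> carrier_vec n"
  using assms by (induction k) (simp_all add: pwl_map_carrier)

theorem theorem1:
  fixes n :: nat and A :: "real mat" and b c :: "real vec" and N :: "real vec \<Rightarrow> real"
  assumes "n \<ge> 2"
    and "A \<in> carrier_mat n n" and "b \<in> carrier_vec n" and "c \<in> carrier_vec n"
    and "is_norm n N"
    and "vec_space.rank n (trailing_cols n (1\<^sub>m n - A)) = n - 1"
    and "\<exists>x \<in> carrier_vec n. \<not> filterlim (\<lambda>k. N ((pwl_map A b c ^^ k) x)) at_top sequentially"
  shows "\<exists>x \<in> carrier_vec n. pwl_map A b c x = x"
proof (rule ccontr)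
  assume no_fixed: "\<not> ?thesis"
  let ?f = "pwl_map A b c"
  define M where "M = 1\<^sub>m n - A"
  have M: "M \<in> carrier_mat n n"
    using assms(2) unfolding M_def by (rule minus_carrier_mat)
  have "n > 0"
    using assms(1) by simp
  obtain v where v: "v \<in> carrier_vec n" "v \<noteq> 0\<^sub>v n"
    "\<And>j. 0 < j \<Longrightarrow> j < n \<Longrightarrow> (\<Sum>i<n. M $$ (i, j) * v $ i) = 0"
    using trailing_cols_left_kernel[OF \<open>n > 0\<close>, of M] by blast
  \<comment> \<open>Since \<open>?f x - x = - M x + \<bar>x $ 0\<bar> b + c\<close> and
    \<open>v\<close> kills all columns of \<open>M\<close> except column 0, pairing with
    \<open>v\<close> leaves a function of \<open>x $ 0\<close> alone, with these
    coefficients.\<close>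
  define p where "p = - (\<Sum>i<n. M $$ (i, 0) * v $ i)"
  define q where "q = (\<Sum>i<n. b $ i * v $ i)"
  define g where "g = (\<Sum>i<n. c $ i * v $ i)"
  have f_nth: "?f x $ i = x $ i - (\<Sum>j<n. M $$ (i, j) * x $ j) + \<bar>x $ 0\<bar> * b $ i + c $ i"
    if "x \<in> carrier_vec n" "i < n" for x i
  proof -
    have "(\<Sum>j<n. M $$ (i, j) * x $ j)
        = (\<Sum>j<n. (if j = i then x $ j else 0) - A $$ (i, j) * x $ j)"
      using that assms(2) by (intro sum.cong) (auto simp: M_def algebra_simps)
    then have "(\<Sum>j<n. M $$ (i, j) * x $ j) = x $ i - (\<Sum>j<n. A $$ (i, j) * x $ j)"
      using that by (simp add: sum_subtractf)
    then show ?thesis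
      using that assms(2-4) by (simp add: pwl_map_def scalar_prod_def lessThan_atLeast0)
  qed
  have drift: "v \<bullet> ?f x = v \<bullet> x + (p * x $ 0 + q * \<bar>x $ 0\<bar> + g)" if x: "x \<in> carrier_vec n" for x
  proof -
    have "(\<Sum>i<n. (\<Sum>j<n. M $$ (i, j) * x $ j) * v $ i)
        = (\<Sum>j<n. (\<Sum>i<n. M $$ (i, j) * v $ i) * x $ j)"
      unfolding sum_distrib_right by (subst sum.swap) (simp add: ac_simps)
    also have "\<dots> = (\<Sum>j\<in>{0}. (\<Sum>i<n. M $$ (i, j) * v $ i) * x $ j)"
      using \<open>n > 0\<close> v(3) by (intro sum.mono_neutral_right) auto
    finally have *: "(\<Sum>i<n. (\<Sum>j<n. M $$ (i, j) * x $ j) * v $ i) = - p * x $ 0"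
      by (simp add: p_def)
    have "v \<bullet> ?f x = (\<Sum>i<n. ?f x $ i * v $ i)"
      using pwl_map_carrier[OF assms(2-4) x] by (simp add: scalar_prod_def lessThan_atLeast0 mult.commute)
    also have "\<dots> = (\<Sum>i<n. x $ i * v $ i - (\<Sum>j<n. M $$ (i, j) * x $ j) * v $ i
        + \<bar>x $ 0\<bar> * (b $ i * v $ i) + c $ i * v $ i)"
    proof (intro sum.cong refl)
      fix i assume "i \<in> {..<n}"
      then have "i < n" by simp
      show "?f x $ i * v $ i = x $ i * v $ i - (\<Sum>j<n. M $$ (i, j) * x $ j) * v $ i
          + \<bar>x $ 0\<bar> * (b $ i * v $ i) + c $ i * v $ i"
        unfolding f_nth[OF x \<open>i < n\<close>] by (simp only: ring_distribs mult.assoc)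
    qed
    also have "\<dots> = (\<Sum>i<n. x $ i * v $ i) - - p * x $ 0 + \<bar>x $ 0\<bar> * q + g"
      by (simp only: sum.distrib sum_subtractf * q_def g_def sum_distrib_left)
    also have "(\<Sum>i<n. x $ i * v $ i) = v \<bullet> x"
      using x by (simp add: scalar_prod_def lessThan_atLeast0 mult.commute)
    finally show ?thesis
      by simp
  qed
  have no_zero: "p * t + q * \<bar>t\<bar> + g \<noteq> 0" for t
  proof
    assume zero: "p * t + q * \<bar>t\<bar> + g = 0"
    \<comment> \<open>A fixed point with first coordinate \<open>t\<close> solves
      \<open>M z = \<bar>t\<bar> b + c\<close>. Moving the contribution of column 0 to the right
      leaves \<open>y\<close> for the other columns to produce, and the assumed zero says exactly
      that \<open>y\<close> is orthogonal to \<open>v\<close>.\<close>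
    define y where "y i = \<bar>t\<bar> * b $ i + c $ i - t * M $$ (i, 0)" for i
    have "(\<Sum>i<n. y i * v $ i)
        = (\<Sum>i<n. \<bar>t\<bar> * (b $ i * v $ i) + c $ i * v $ i - t * (M $$ (i, 0) * v $ i))"
      by (intro sum.cong) (auto simp: y_def algebra_simps)
    also have "\<dots> = \<bar>t\<bar> * q + g - t * - p"
      by (simp only: sum.distrib sum_subtractf q_def g_def p_def sum_distrib_left minus_minus)
    also have "\<dots> = 0"
      using zero by (simp add: algebra_simps)
    finally obtain x where x: "x 0 = 0" "\<And>i. i < n \<Longrightarrow> (\<Sum>j<n. M $$ (i, j) * x j) = y i"
      using left_kernel_orthogonal_imp_range[OF assms(1) M assms(6)[folded M_def] v] by blast
    define z where "z = vec n (x(0 := t))"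
    have z: "z \<in> carrier_vec n"
      by (simp add: z_def)
    have "(\<Sum>j<n. M $$ (i, j) * z $ j) = t * M $$ (i, 0) + y i" if "i < n" for i
    proof -
      have "(\<Sum>j<n. M $$ (i, j) * z $ j)
          = (\<Sum>j<n. (if j = 0 then t * M $$ (i, 0) else 0) + M $$ (i, j) * x j)"
        using x(1) by (intro sum.cong) (auto simp: z_def)
      then show ?thesis
        using x(2)[OF that] \<open>n > 0\<close> by (simp add: sum.distrib)
    qed
    moreover have "z $ 0 = t"
      using \<open>n > 0\<close> by (simp add: z_def)
    ultimately have "?f z = z"
      using z pwl_map_carrier[OF assms(2-4) z] f_nth[OF z]
      by (intro eq_vecI) (auto simp: y_def)
    with no_fixed z show False
      by blast
  qed
  have "g \<noteq> 0"
    using no_zero[of 0] by simp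
  obtain x where x: "x \<in> carrier_vec n"
    and bounded: "\<not> filterlim (\<lambda>k. N ((?f ^^ k) x)) at_top sequentially"
    using assms(7) by blast
  note orbit = pwl_map_iterate_carrier[OF assms(2-4) x]
  \<comment> \<open>Each application of the map raises \<open>g * (v \<bullet> x)\<close> by at
    least \<open>g\<^sup>2\<close>, whatever the sign of \<open>g\<close>.\<close>
  have growth: "g * (v \<bullet> x) + real k * g\<^sup>2 \<le> g * (v \<bullet> (?f ^^ k) x)" for k
  proof (induction k)
    case (Suc k)
    then show ?case
      using drift[OF orbit[of k]] no_zero_imp_mult_ge_square[OF no_zero, of "(?f ^^ k) x $ 0"]
      by (simp add: algebra_simps)
  qed simp
  \<comment> \<open>Bounding the product with \<open>g \<cdot>\<^sub>v v\<close> instead of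
    \<open>v\<close> lets the one-sided estimate cover both signs of \<open>g\<close>.\<close>
  obtain C where C: "C > 0" "\<And>x. x \<in> carrier_vec n \<Longrightarrow> (g \<cdot>\<^sub>v v) \<bullet> x \<le> C * N x"
    using scalar_prod_le_is_norm[OF assms(5), of "g \<cdot>\<^sub>v v"] v(1) by auto
  have lower: "\<forall>k. (g * (v \<bullet> x) + real k * g\<^sup>2) / C \<le> N ((?f ^^ k) x)"
  proof
    fix k
    show "(g * (v \<bullet> x) + real k * g\<^sup>2) / C \<le> N ((?f ^^ k) x)"
      using growth[of k] C(1) C(2)[OF orbit[of k]] v(1) orbit[of k] by (simp add: field_simps)
  qed
  have lim: "filterlim (\<lambda>k. (g * (v \<bullet> x) + real k * g\<^sup>2) / C) at_top sequentially"
  proof -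
    have "filterlim (\<lambda>k. real k * (g\<^sup>2 / C)) at_top sequentially"
      using \<open>g \<noteq> 0\<close> C(1)
      by (intro filterlim_at_top_mult_tendsto_pos[OF tendsto_const _ filterlim_real_sequentially]) simp
    then show ?thesis
      unfolding add_divide_distrib times_divide_eq_right[symmetric]
      by (intro filterlim_tendsto_add_at_top[OF tendsto_const])
  qed
  have "filterlim (\<lambda>k. N ((?f ^^ k) x)) at_top sequentially"
    by (intro filterlim_at_top_mono[OF lim always_eventually[OF lower]])
  with bounded show False ..
qed

end
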